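(* It holds that $$\log(\rho_n^{\mathrm{var}})=\inf_{\alpha\in\mathbb{R}^n,\ \beta\in\mathbb{R}^{n\times m}}\ \sum_{i=1}^n\{\alpha_i+\beta_i^\top\mu_i-1\}+\sup_{x\in\mathcal{X}^n}\Big\{\log(F(x))-\sum_{i=1}^n\log(\alpha_i+\beta_i^\top g_i(x_i))\Big\}.$$ In addition, if (for given $\alpha,\beta$) the function $x\mapsto\log(F(x))-\sum_{i=1}^n\log(\alpha_i+\beta_i^\top g_i(x_i))$ is convex and $\mathcal{X}$ is compact, then $$\sup_{x\in\mathcal{X}^n}\Big\{\log(F(x))-\sum_{i=1}^n\log(\alpha_i+\beta_i^\top g_i(x_i))\Big\}=\sup_{x\in\mathrm{Extremal}(\mathcal{X}^n)}\Big\{\log(F(x))-\sum_{i=1}^n\log(\alpha_i+\beta_i^\top g_i(x_i))\Big\}.$$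
   Context: Let $\mathcal{X}\subset\mathbb{R}$ (a convex set in the second assertion, where convexity of a function on $\mathcal{X}^n$ is assumed), $F:\mathcal{X}^n\to\mathbb{R}^+$, and for $i=1,\dots,n$ let $g_i:\mathcal{X}\to\mathbb{R}^m$ be measurable and $\mu_i\in\mathbb{R}^m$ such that there exists a probability distribution $p_i$ on $\mathcal{X}$ with $\int_{\mathcal{X}}g_i\,dp_i=\mu_i$. Define $$\rho_n^{\mathrm{var}}=\inf\Big\{\prod_{i=1}^n(\alpha_i+\beta_i^\top\mu_i)\ :\ u_i:\mathcal{X}\to\mathbb{R}^+,\ \alpha_i\in\mathbb{R},\ \beta_i\in\mathbb{R}^m,\ u_i(x_i)\leqslant\alpha_i+\beta_i^\top g_i(x_i)\ \forall i,\forall x_i\in\mathcal{X},\ F(x)\leqslant\prod_{i=1}^n u_i(x_i)\ \forall x\in\mathcal{X}^n\Big\}.$$ Conventions: $\inf\emptyset=+\infty$, $\log 0=-\infty$, $\log(+\infty)=+\infty$. The presence of the logarithms restricts $(\alpha,\beta)$ to those with $\alpha_i+\beta_i^\top g_i(x_i)>0$ for all $i$ and all $x_i\in\mathcal{X}$. $\mathrm{Extremal}(\mathcal{X}^n)$ denotes the set of extreme points of $\mathcal{X}^n$. *)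

theory Defs
  imports "HOL-Analysis.Analysis" "HOL-Probability.Probability"
begin

definition cart_power :: "real set \<Rightarrow> (real ^ 'n) set" where
  "cart_power X = {x. \<forall>i. x $ i \<in> X}"

(* Only nonnegative arguments matter; negative ones are sent to -\<infinity> merely to make
   the function total. *)
definition ereal_ln :: "ereal \<Rightarrow> ereal" where
  "ereal_ln y = (if y \<le> 0 then -\<infinity> else if y = \<infinity> then \<infinity> else ereal (ln (real_of_ereal y)))"

(* The analogue of convex_on for extended-real-valued functions, needed because log (F x)
   is -\<infinity> where F vanishes. The sum on the right follows the ereal convention
   \<infinity> + (-\<infinity>) = \<infinity>, so the inequality is equivalent to convexity of the
   epigraph. *)
definition ereal_convex_on :: "'a::real_vector set \<Rightarrow> ('a \<Rightarrow> ereal) \<Rightarrow> bool" where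
  "ereal_convex_on S f \<longleftrightarrow> convex S \<and>
    (\<forall>x\<in>S. \<forall>y\<in>S. \<forall>u\<ge>0. \<forall>v\<ge>0. u + v = 1 \<longrightarrow>
      f (u *\<^sub>R x + v *\<^sub>R y) \<le> ereal u * f x + ereal v * f y)"

(* As an infimum in ereal it equals \<infinity> when no (u, \<alpha>, \<beta>) is feasible. *)
definition rho_var ::
  "real set \<Rightarrow> (real ^ 'n \<Rightarrow> real) \<Rightarrow> ('n \<Rightarrow> real \<Rightarrow> real ^ 'm) \<Rightarrow> ('n \<Rightarrow> real ^ 'm) \<Rightarrow> ereal" where
  "rho_var X F g \<mu> =
    Inf {ereal (\<Prod>i\<in>UNIV. \<alpha> $ i + \<beta> $ i \<bullet> \<mu> i)
         | (u :: 'n \<Rightarrow> real \<Rightarrow> real) (\<alpha> :: real ^ 'n) (\<beta> :: real ^ 'm ^ 'n).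
           (\<forall>i. \<forall>t\<in>X. 0 \<le> u i t \<and> u i t \<le> \<alpha> $ i + \<beta> $ i \<bullet> g i t) \<and>
           (\<forall>x\<in>cart_power X. F x \<le> (\<Prod>i\<in>UNIV. u i (x $ i)))}"

definition admissible ::
  "real set \<Rightarrow> ('n \<Rightarrow> real \<Rightarrow> real ^ 'm) \<Rightarrow> real ^ 'n \<Rightarrow> real ^ 'm ^ 'n \<Rightarrow> bool" where
  "admissible X g \<alpha> \<beta> \<longleftrightarrow> (\<forall>i. \<forall>t\<in>X. 0 < \<alpha> $ i + \<beta> $ i \<bullet> g i t)"

(* The real ln suffices in the sum, since its arguments are positive for admissible (\<alpha>, \<beta>). *)
definition log_ratio ::
  "(real ^ 'n \<Rightarrow> real) \<Rightarrow> ('n \<Rightarrow> real \<Rightarrow> real ^ 'm) \<Rightarrow> real ^ 'n \<Rightarrow> real ^ 'm ^ 'n \<Rightarrow> real ^ 'n \<Rightarrow> ereal" where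
  "log_ratio F g \<alpha> \<beta> x =
    ereal_ln (ereal (F x)) - ereal (\<Sum>i\<in>UNIV. ln (\<alpha> $ i + \<beta> $ i \<bullet> g i (x $ i)))"

end

theory Submission
  imports Defs
begin

text \<open>Replacing every \<open>u\<^sub>i\<close> by \<open>w\<^sub>i = \<alpha>\<^sub>i + \<beta>\<^sub>i \<bullet> g\<^sub>i\<close> keeps it feasible, and \<open>w\<^sub>i\<close> has mean
  \<open>\<alpha>\<^sub>i + \<beta>\<^sub>i \<bullet> \<mu>\<^sub>i\<close>. Rescaling all \<open>w\<^sub>i\<close> to mean \<open>1\<close> makes the linear term vanish and
  gives one inequality, after \<open>\<alpha>\<^sub>i\<close> has been increased by \<open>\<epsilon>\<close> to make \<open>w\<^sub>i\<close> positive. Rescaling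
  one \<open>w\<^sub>i\<close> by the exponential of the supremum makes it feasible, and \<open>ln t \<le> t - 1\<close> gives the
  other inequality. The second assertion is the theorem of Krein, Milman and Minkowski applied to
  the convex sublevel sets.\<close>

section \<open>The extended logarithm and the ratio\<close>

lemma ereal_ln_of_pos: "0 < r \<Longrightarrow> ereal_ln (ereal r) = ereal (ln r)"
  by (simp add: ereal_ln_def)

text \<open>As \<open>exp r\<close> is positive, both sides fail for \<open>y \<le> 0\<close>. This
  adjunction moves order arguments from \<open>ereal_ln\<close> to its argument, so monotonicity and
  infima need no separate calculus.\<close>

lemma le_ereal_ln_iff: "ereal r \<le> ereal_ln y \<longleftrightarrow> ereal (exp r) \<le> y"
proof (cases y)
  case (real s)
  then show ?thesis
    by (auto simp: ereal_ln_def ln_ge_iff not_le intro: less_le_trans[OF exp_gt_zero])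
      (metis exp_gt_zero not_le order_trans)
qed (auto simp: ereal_ln_def)

lemma ereal_ln_mono:
  assumes "y \<le> z"
  shows "ereal_ln y \<le> ereal_ln z"
proof (cases "ereal_ln y")
  case (real r)
  then have "ereal (exp r) \<le> y"
    by (simp flip: le_ereal_ln_iff)
  then show ?thesis
    unfolding real le_ereal_ln_iff using assms by (rule order_trans)
next
  case PInf
  then show ?thesis
    using assms by (auto simp: ereal_ln_def split: if_splits)
qed simp

text \<open>For finite \<open>L\<close> the adjunction turns the claim into the bound
  \<open>exp r\<close> below \<open>Inf A\<close>. For \<open>L = \<infinity>\<close> every member
  of \<open>A\<close> is infinite, and so is the infimum, also for empty \<open>A\<close>.\<close>

lemma le_ereal_ln_Inf:
  assumes "\<And>a. a \<in> A \<Longrightarrow> L \<le> ereal_ln a"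
  shows "L \<le> ereal_ln (Inf A)"
proof (cases L)
  case (real r)
  then show ?thesis
    using assms by (auto simp: le_ereal_ln_iff intro: Inf_greatest)
next
  case PInf
  have "a = \<infinity>" if "a \<in> A" for a
    using assms[OF that] PInf by (cases a) (auto simp: ereal_ln_def split: if_splits)
  then have "Inf A = \<infinity>"
    by (auto simp: Inf_eq_PInfty)
  then show ?thesis
    by (simp add: ereal_ln_def)
qed simp

text \<open>This links the supremum to feasibility: exponentiating a bound on the ratio gives a
  constraint of the kind in \<open>rho_var\<close>. Where \<open>F x \<le> 0\<close> the ratio is
  -\<infinity> and the product on the right is positive, so both sides hold.\<close>

lemma log_ratio_le_iff:
  fixes F :: "real ^ 'n \<Rightarrow> real"
  assumes "\<And>i. 0 < \<alpha> $ i + \<beta> $ i \<bullet> g i (x $ i)"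
  shows "log_ratio F g \<alpha> \<beta> x \<le> ereal s \<longleftrightarrow>
    F x \<le> exp s * (\<Prod>i\<in>UNIV. \<alpha> $ i + \<beta> $ i \<bullet> g i (x $ i))"
proof -
  define W where "W = (\<Prod>i\<in>UNIV. \<alpha> $ i + \<beta> $ i \<bullet> g i (x $ i))"
  have W: "0 < W"
    unfolding W_def using assms by (intro prod_pos) auto
  have lnW: "(\<Sum>i\<in>UNIV. ln (\<alpha> $ i + \<beta> $ i \<bullet> g i (x $ i))) = ln W"
    unfolding W_def using assms by (subst ln_prod) (auto simp: less_imp_neq[symmetric])
  show ?thesis
  proof (cases "0 < F x")
    case True
    have "ln (F x) \<le> s + ln W \<longleftrightarrow> ln (F x) \<le> ln (exp s * W)"
      using W by (simp add: ln_mult)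
    also have "\<dots> \<longleftrightarrow> F x \<le> exp s * W"
      using True W by (intro ln_le_cancel_iff) auto
    finally show ?thesis
      using True by (auto simp: log_ratio_def lnW ereal_ln_of_pos simp flip: W_def)
  next
    case False
    then have "F x \<le> exp s * W"
      using W by (meson exp_gt_zero mult_pos_pos not_less order_less_imp_le order_trans)
    then show ?thesis
      using False by (simp add: log_ratio_def ereal_ln_def flip: W_def)
  qed
qed

section \<open>Means of affine functions\<close>

lemma affine_mean:
  fixes g :: "'b \<Rightarrow> 'a::euclidean_space"
  assumes "prob_space p" "has_bochner_integral p g \<mu>"
  shows "has_bochner_integral p (\<lambda>t. a + b \<bullet> g t) (a + b \<bullet> \<mu>)"
proof -
  interpret prob_space p by fact
  have "has_bochner_integral p (\<lambda>t. a) a"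
    by (simp add: has_bochner_integral_iff prob_space)
  then show ?thesis
    using assms(2) by (intro has_bochner_integral_add has_bochner_integral_inner_right) auto
qed

lemma affine_mean_nonneg:
  fixes g :: "'b \<Rightarrow> 'a::euclidean_space"
  assumes "prob_space p" "has_bochner_integral p g \<mu>"
    and "\<And>t. t \<in> space p \<Longrightarrow> 0 \<le> a + b \<bullet> g t"
  shows "0 \<le> a + b \<bullet> \<mu>"
  using affine_mean[OF assms(1,2), of a b] assms(3)
  by (metis (mono_tags, lifting) Bochner_Integration.integral_nonneg has_bochner_integral_integral_eq)

text \<open>Strictness survives integration because the total mass is 1. It is what allows taking
  the logarithm of the means.\<close>

lemma affine_mean_pos:
  fixes g :: "'b \<Rightarrow> 'a::euclidean_space"
  assumes "prob_space p" "has_bochner_integral p g \<mu>"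
    and "\<And>t. t \<in> space p \<Longrightarrow> 0 < a + b \<bullet> g t"
  shows "0 < a + b \<bullet> \<mu>"
proof -
  have "has_bochner_integral p (\<lambda>t. a + b \<bullet> g t) (a + b \<bullet> \<mu>)"
    by (rule affine_mean) fact+
  then show ?thesis
    using prob_space.expectation_greater[OF assms(1), of "\<lambda>t. a + b \<bullet> g t" 0] assms(3)
    by (simp add: has_bochner_integral_iff)
qed

section \<open>Convexity and extreme points\<close>

text \<open>The level \<open>M\<close> may be infinite, as a supremum can be: nonnegative
  coefficients distribute over any \<open>M\<close> in \<open>ereal\<close>, so
  \<open>u * M + v * M = M\<close> still holds.\<close>

lemma ereal_convex_on_sublevel:
  assumes "ereal_convex_on S f"
  shows "convex {x \<in> S. f x \<le> M}"
proof (rule convexI)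
  fix x y and u v :: real
  assume xy: "x \<in> {x \<in> S. f x \<le> M}" "y \<in> {x \<in> S. f x \<le> M}" and uv: "0 \<le> u" "0 \<le> v" "u + v = 1"
  have "u *\<^sub>R x + v *\<^sub>R y \<in> S"
    using assms xy uv by (auto simp: ereal_convex_on_def convex_def)
  moreover have "f (u *\<^sub>R x + v *\<^sub>R y) \<le> ereal u * f x + ereal v * f y"
    using assms xy uv by (auto simp: ereal_convex_on_def)
  moreover have "\<dots> \<le> ereal u * M + ereal v * M"
    using xy uv by (intro add_mono ereal_mult_left_mono) auto
  moreover have "\<dots> = M"
    using uv by (metis ereal_left_distrib ereal_less_eq(5) mult_1 one_ereal_def plus_ereal.simps(1))
  ultimately show "u *\<^sub>R x + v *\<^sub>R y \<in> {x \<in> S. f x \<le> M}"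
    by auto
qed

text \<open>The sublevel set at the supremum over the extreme points is convex and contains them,
  hence contains their convex hull, which is \<open>S\<close>.\<close>

lemma SUP_eq_SUP_extreme_points:
  fixes S :: "'a::euclidean_space set"
  assumes "compact S" "ereal_convex_on S f"
  shows "(SUP x\<in>S. f x) = (SUP x\<in>{x. x extreme_point_of S}. f x)" (is "_ = ?M")
proof (rule antisym)
  have "S = convex hull {x. x extreme_point_of S}"
    using assms by (intro Krein_Milman_Minkowski) (auto simp: ereal_convex_on_def)
  also have "\<dots> \<subseteq> {x \<in> S. f x \<le> ?M}"
    by (rule hull_minimal)
      (auto simp: extreme_point_of_def intro!: SUP_upper ereal_convex_on_sublevel assms)
  finally show "(SUP x\<in>S. f x) \<le> ?M"
    by (auto intro: SUP_least)
qed (auto simp: extreme_point_of_def intro!: SUP_subset_mono)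

text \<open>A compact convex subset of the line is a closed interval, possibly empty, so its power
  is a box.\<close>

lemma compact_cart_power:
  assumes "compact X" "convex X"
  shows "compact (cart_power X :: (real ^ 'n) set)"
proof -
  obtain a b where "X = {a..b}"
    using assms connected_compact_interval_1 convex_connected by metis
  then have "cart_power X = cbox (vec a) (vec b :: real ^ 'n)"
    by (auto simp: cart_power_def mem_box_cart)
  then show ?thesis
    by simp
qed

section \<open>The formula for the logarithm of the infimum\<close>

text \<open>The mean of an affine function of \<open>g\<^sub>i\<close> with respect to \<open>p\<^sub>i\<close> enters only through its
  sign, which is what \<open>nonneg\<close> and \<open>pos\<close> record.\<close>

lemma ereal_ln_rho_var:
  fixes F :: "real ^ 'n \<Rightarrow> real" and g :: "'n \<Rightarrow> real \<Rightarrow> real ^ 'm"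
  assumes nonneg: "\<And>i a b. (\<And>t. t \<in> X \<Longrightarrow> 0 \<le> a + b \<bullet> g i t) \<Longrightarrow> 0 \<le> a + b \<bullet> \<mu> i"
    and pos: "\<And>i a b. (\<And>t. t \<in> X \<Longrightarrow> 0 < a + b \<bullet> g i t) \<Longrightarrow> 0 < a + b \<bullet> \<mu> i"
  shows "ereal_ln (rho_var X F g \<mu>) =
    (INF (\<alpha>, \<beta>) \<in> {(\<alpha>, \<beta>). admissible X g \<alpha> \<beta>}.
       ereal (\<Sum>i\<in>UNIV. \<alpha> $ i + \<beta> $ i \<bullet> \<mu> i - 1) + (SUP x \<in> cart_power X. log_ratio F g \<alpha> \<beta> x))"
    (is "_ = ?R")
proof (rule antisym)
  have rho_le: "rho_var X F g \<mu> \<le> ereal (\<Prod>i\<in>UNIV. \<alpha> $ i + \<beta> $ i \<bullet> \<mu> i)"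
    if "\<And>i t. t \<in> X \<Longrightarrow> 0 \<le> \<alpha> $ i + \<beta> $ i \<bullet> g i t"
      "\<And>x. x \<in> cart_power X \<Longrightarrow> F x \<le> (\<Prod>i\<in>UNIV. \<alpha> $ i + \<beta> $ i \<bullet> g i (x $ i))" for \<alpha> \<beta>
    unfolding rho_var_def using that
    by (intro Inf_lower CollectI exI[of _ "\<lambda>i t. \<alpha> $ i + \<beta> $ i \<bullet> g i t"] exI[of _ \<alpha>] exI[of _ \<beta>]) auto
  show "ereal_ln (rho_var X F g \<mu>) \<le> ?R"
  proof (safe intro!: INF_greatest)
    fix \<alpha> \<beta>
    assume adm: "admissible X g \<alpha> \<beta>"
    have w: "0 < \<alpha> $ i + \<beta> $ i \<bullet> g i t" if "t \<in> X" for i t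
      using adm that by (auto simp: admissible_def)
    have m: "0 < \<alpha> $ i + \<beta> $ i \<bullet> \<mu> i" for i
      using w by (rule pos)
    \<comment> \<open>A real upper bound \<open>s\<close> replaces the supremum, which may be
      infinite and then has no exponential to scale by.\<close>
    have bound: "ereal_ln (rho_var X F g \<mu>) \<le> ereal (\<Sum>i\<in>UNIV. \<alpha> $ i + \<beta> $ i \<bullet> \<mu> i - 1) + ereal s"
      if s: "(SUP x \<in> cart_power X. log_ratio F g \<alpha> \<beta> x) \<le> ereal s" for s
    proof -
      \<comment> \<open>The whole factor \<open>exp s\<close> goes to one index;
        \<open>undefined\<close> merely names some element of \<open>'n\<close>.\<close>
      define c where "c i = (if i = (undefined :: 'n) then exp s else 1)" for i
      have c: "0 < c i" "(\<Prod>i\<in>UNIV. c i) = exp s" for i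
        by (auto simp: c_def)
      define \<alpha>' where "\<alpha>' = (\<chi> i. c i * \<alpha> $ i)"
      define \<beta>' where "\<beta>' = (\<chi> i. c i *\<^sub>R \<beta> $ i)"
      have scale: "\<alpha>' $ i + \<beta>' $ i \<bullet> z = c i * (\<alpha> $ i + \<beta> $ i \<bullet> z)" for i z
        by (simp add: \<alpha>'_def \<beta>'_def algebra_simps)
      have "rho_var X F g \<mu> \<le> ereal (\<Prod>i\<in>UNIV. \<alpha>' $ i + \<beta>' $ i \<bullet> \<mu> i)"
      proof (rule rho_le)
        show "0 \<le> \<alpha>' $ i + \<beta>' $ i \<bullet> g i t" if "t \<in> X" for i t
          unfolding scale using w[OF that, of i] c(1)[of i] by simp
        show "F x \<le> (\<Prod>i\<in>UNIV. \<alpha>' $ i + \<beta>' $ i \<bullet> g i (x $ i))" if "x \<in> cart_power X" for x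
        proof -
          have "log_ratio F g \<alpha> \<beta> x \<le> ereal s"
            using s that by (meson SUP_le_iff)
          then show ?thesis
            unfolding scale prod.distrib c(2)
            using that w by (subst (asm) log_ratio_le_iff) (auto simp: cart_power_def)
        qed
      qed
      then have "ereal_ln (rho_var X F g \<mu>) \<le> ereal_ln (ereal (\<Prod>i\<in>UNIV. \<alpha>' $ i + \<beta>' $ i \<bullet> \<mu> i))"
        by (rule ereal_ln_mono)
      also have "\<dots> = ereal (s + (\<Sum>i\<in>UNIV. ln (\<alpha> $ i + \<beta> $ i \<bullet> \<mu> i)))"
        unfolding scale prod.distrib c(2) using m
        by (subst ereal_ln_of_pos)
          (auto intro!: mult_pos_pos prod_pos simp: ln_mult ln_prod prod_pos less_imp_neq[symmetric])
      \<comment> \<open>The bound \<open>ln t \<le> t - 1\<close> is applied to each mean. It is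
        sharp at 1, which is why the converse normalises the means to 1.\<close>
      also have "\<dots> \<le> ereal (\<Sum>i\<in>UNIV. \<alpha> $ i + \<beta> $ i \<bullet> \<mu> i - 1) + ereal s"
        using m by (auto intro!: sum_mono ln_le_minus_one simp: add.commute)
      finally show ?thesis .
    qed
    show "ereal_ln (rho_var X F g \<mu>) \<le>
      ereal (\<Sum>i\<in>UNIV. \<alpha> $ i + \<beta> $ i \<bullet> \<mu> i - 1) + (SUP x \<in> cart_power X. log_ratio F g \<alpha> \<beta> x)"
    proof (cases "SUP x \<in> cart_power X. log_ratio F g \<alpha> \<beta> x")
      case (real s)
      then show ?thesis
        using bound[of s] by simp
    next
      case MInf
      \<comment> \<open>Now every real \<open>s\<close> is an upper bound, so \<open>s\<close> can
        be chosen to make the right side of \<open>bound\<close> equal to any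
        \<open>B\<close>.\<close>
      have "ereal_ln (rho_var X F g \<mu>) \<le> ereal B" for B
        using bound[of "B - (\<Sum>i\<in>UNIV. \<alpha> $ i + \<beta> $ i \<bullet> \<mu> i - 1)"] MInf by simp
      then have "ereal_ln (rho_var X F g \<mu>) = -\<infinity>"
        by (rule ereal_bot)
      then show ?thesis
        by simp
    qed simp
  qed
next
  show "?R \<le> ereal_ln (rho_var X F g \<mu>)"
    unfolding rho_var_def
  proof (safe intro!: le_ereal_ln_Inf)
    fix u :: "'n \<Rightarrow> real \<Rightarrow> real" and \<alpha> \<beta>
    assume u: "\<forall>i. \<forall>t\<in>X. 0 \<le> u i t \<and> u i t \<le> \<alpha> $ i + \<beta> $ i \<bullet> g i t"
      and Fu: "\<forall>x\<in>cart_power X. F x \<le> (\<Prod>i\<in>UNIV. u i (x $ i))"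
    define m where "m i = \<alpha> $ i + \<beta> $ i \<bullet> \<mu> i" for i
    have m: "0 \<le> m i" for i
      unfolding m_def using u by (intro nonneg) (meson order_trans)
    \<comment> \<open>Both an affine bound and its mean \<open>m i\<close> may vanish. Adding
      \<epsilon> makes the first admissible and allows division by the second.\<close>
    have R_le: "?R \<le> ereal (ln (\<Prod>i\<in>UNIV. m i + \<epsilon>))" if \<epsilon>: "0 < \<epsilon>" for \<epsilon>
    proof -
      define \<alpha>' where "\<alpha>' = (\<chi> i. (\<alpha> $ i + \<epsilon>) / (m i + \<epsilon>))"
      define \<beta>' where "\<beta>' = (\<chi> i. (1 / (m i + \<epsilon>)) *\<^sub>R \<beta> $ i)"
      have m': "0 < m i + \<epsilon>" for i
        using m[of i] \<epsilon> by simp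
      have scale: "\<alpha>' $ i + \<beta>' $ i \<bullet> z = (\<alpha> $ i + \<beta> $ i \<bullet> z + \<epsilon>) / (m i + \<epsilon>)" for i z
        by (simp add: \<alpha>'_def \<beta>'_def add_divide_distrib)
      have P: "0 < (\<Prod>i\<in>UNIV. m i + \<epsilon>)"
        using m' by (intro prod_pos) auto
      have one: "\<alpha>' $ i + \<beta>' $ i \<bullet> \<mu> i = 1" for i
        unfolding scale using m'[of i] by (simp add: m_def)
      have w: "0 < \<alpha>' $ i + \<beta>' $ i \<bullet> g i t" if "t \<in> X" for i t
      proof -
        have "0 \<le> \<alpha> $ i + \<beta> $ i \<bullet> g i t"
          using u that by (meson order_trans)
        then show ?thesis
          unfolding scale using m'[of i] \<epsilon> by simp
      qed
      have "log_ratio F g \<alpha>' \<beta>' x \<le> ereal (ln (\<Prod>i\<in>UNIV. m i + \<epsilon>))" if x: "x \<in> cart_power X" for x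
      proof (subst log_ratio_le_iff)
        have xX: "x $ i \<in> X" for i
          using x by (simp add: cart_power_def)
        show "0 < \<alpha>' $ i + \<beta>' $ i \<bullet> g i (x $ i)" for i
          using w xX by blast
        have "F x \<le> (\<Prod>i\<in>UNIV. u i (x $ i))"
          using Fu x by blast
        also have "\<dots> \<le> (\<Prod>i\<in>UNIV. \<alpha> $ i + \<beta> $ i \<bullet> g i (x $ i) + \<epsilon>)"
          using u xX \<epsilon> by (intro prod_mono conjI) (auto intro: add_increasing2)
        \<comment> \<open>The normalising denominators multiply to exactly the factor whose
          logarithm bounds the ratio.\<close>
        also have "\<dots> = exp (ln (\<Prod>i\<in>UNIV. m i + \<epsilon>)) * (\<Prod>i\<in>UNIV. \<alpha>' $ i + \<beta>' $ i \<bullet> g i (x $ i))"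
          unfolding scale prod_dividef using P less_imp_neq[OF P] by (simp del: prod_zero_iff)
        finally show "F x \<le> \<dots>" .
      qed
      then have "(SUP x \<in> cart_power X. log_ratio F g \<alpha>' \<beta>' x) \<le> ereal (ln (\<Prod>i\<in>UNIV. m i + \<epsilon>))"
        by (rule SUP_least)
      moreover have "admissible X g \<alpha>' \<beta>'"
        using w by (simp add: admissible_def)
      then have "?R \<le> ereal (\<Sum>i\<in>UNIV. \<alpha>' $ i + \<beta>' $ i \<bullet> \<mu> i - 1)
          + (SUP x \<in> cart_power X. log_ratio F g \<alpha>' \<beta>' x)"
        by (intro INF_lower2[of "(\<alpha>', \<beta>')"]) auto
      then have "?R \<le> (SUP x \<in> cart_power X. log_ratio F g \<alpha>' \<beta>' x)"
        unfolding one by simp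
      ultimately show ?thesis
        by (rule order_trans[rotated])
    qed
    have "?R \<le> ereal_ln (ereal (\<Prod>i\<in>UNIV. m i))"
    proof (cases ?R)
      case (real r)
      \<comment> \<open>The limit \<epsilon> to 0 is taken after exponentiating: the limiting
        product may be 0, where the real \<open>ln\<close> is not continuous.\<close>
      have "exp r \<le> (\<Prod>i\<in>UNIV. m i + \<epsilon>)" if "0 < \<epsilon>" for \<epsilon>
      proof -
        have "0 < (\<Prod>i\<in>UNIV. m i + \<epsilon>)"
          using m that by (intro prod_pos) (auto intro: add_nonneg_pos)
        moreover have "r \<le> ln (\<Prod>i\<in>UNIV. m i + \<epsilon>)"
          using R_le[OF that] unfolding real by simp
        ultimately show ?thesis
          by (simp add: ln_ge_iff)
      qed
      moreover have "((\<lambda>\<epsilon>. \<Prod>i\<in>UNIV. m i + \<epsilon>) \<longlongrightarrow> (\<Prod>i\<in>UNIV. m i + 0)) (at_right 0)"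
        by (intro tendsto_intros)
      ultimately have "exp r \<le> (\<Prod>i\<in>UNIV. m i + 0)"
        by (intro tendsto_lowerbound[of _ _ "at_right (0::real)"])
          (auto simp: eventually_at_filter)
      then show ?thesis
        unfolding real le_ereal_ln_iff by simp
    next
      case PInf
      then show ?thesis
        using R_le[of 1] by simp
    qed simp
    then show "?R \<le> ereal_ln (ereal (\<Prod>i\<in>UNIV. \<alpha> $ i + \<beta> $ i \<bullet> \<mu> i))"
      unfolding m_def .
  qed
qed

theorem proposition3:
  fixes X :: "real set"
    and F :: "real ^ 'n \<Rightarrow> real"
    and g :: "'n \<Rightarrow> real \<Rightarrow> real ^ 'm"
    and \<mu> :: "'n \<Rightarrow> real ^ 'm"
  assumes "\<And>x. x \<in> cart_power X \<Longrightarrow> 0 \<le> F x"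
    and "\<And>i. g i \<in> borel_measurable (restrict_space borel X)"
    and "\<And>i. \<exists>p. prob_space p \<and> sets p = sets (restrict_space borel X) \<and>
              has_bochner_integral p (g i) (\<mu> i)"
  shows "ereal_ln (rho_var X F g \<mu>) =
           (INF (\<alpha>, \<beta>) \<in> {(\<alpha>, \<beta>). admissible X g \<alpha> \<beta>}.
              ereal (\<Sum>i\<in>UNIV. \<alpha> $ i + \<beta> $ i \<bullet> \<mu> i - 1)
              + (SUP x \<in> cart_power X. log_ratio F g \<alpha> \<beta> x))
       \<and> (\<forall>\<alpha> \<beta>. admissible X g \<alpha> \<beta> \<longrightarrow> convex X \<longrightarrow> compact X \<longrightarrow>
            ereal_convex_on (cart_power X) (log_ratio F g \<alpha> \<beta>) \<longrightarrow>
            (SUP x \<in> cart_power X. log_ratio F g \<alpha> \<beta> x) =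
            (SUP x \<in> {x. x extreme_point_of cart_power X}. log_ratio F g \<alpha> \<beta> x))"
proof (intro conjI allI impI)
  \<comment> \<open>Equal sigma-algebras have equal underlying spaces, so positivity on
    \<open>X\<close> is positivity on all of \<open>space p\<close>.\<close>
  have ex: "\<exists>p. prob_space p \<and> space p = X \<and> has_bochner_integral p (g i) (\<mu> i)" for i
    using assms(3)[of i] by (metis sets_eq_imp_space_eq space_borel space_restrict_space Int_UNIV_right)
  show "ereal_ln (rho_var X F g \<mu>) =
    (INF (\<alpha>, \<beta>) \<in> {(\<alpha>, \<beta>). admissible X g \<alpha> \<beta>}.
       ereal (\<Sum>i\<in>UNIV. \<alpha> $ i + \<beta> $ i \<bullet> \<mu> i - 1) + (SUP x \<in> cart_power X. log_ratio F g \<alpha> \<beta> x))"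
    by (rule ereal_ln_rho_var) (metis affine_mean_nonneg ex, metis affine_mean_pos ex)
qed (rule SUP_eq_SUP_extreme_points, auto intro: compact_cart_power)

end
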